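(* Let $d\ge 2$ be an integer and $0<\varepsilon\le 1$. There exists a $d$-dimensional $\varepsilon$-Universal Programmable Hybrid Processor $\mathcal{P}=\{\mathcal{P}_\psi\}_\psi\subset CPTP(\mathcal{H}_M,\mathcal{H}_D\otimes\mathcal{H}_M)$, with $\dim\mathcal{H}_D=d$, whose memory dimension $m=\dim\mathcal{H}_M$ satisfies $$m\le\left(\frac{1}{\varepsilon}\right)^{4d\ln(d)} .$$
   Context: $CPTP(\mathcal{H}_M,\mathcal{H}_D\otimes\mathcal{H}_M)$ is the set of completely positive trace-preserving maps (quantum channels) from operators on $\mathcal{H}_M$ to operators on $\mathcal{H}_D\otimes\mathcal{H}_M$; $\mathcal{U}(\mathcal{H}_D)$ is the set of unitaries on $\mathcal{H}_D$; $\|\cdot\|_1$ is the trace norm; $\ln$ is the natural logarithm. $\mathcal{H}_D$ (data space, dimension $d$) and $\mathcal{H}_M$ (memory space, dimension $m$) are finite-dimensional complex Hilbert spaces. Definition ($\varepsilon$-UPHP). A family of channels $\mathcal{P}=\{\mathcal{P}_\psi\}_\psi\subset CPTP(\mathcal{H}_M,\mathcal{H}_D\otimes\mathcal{H}_M)$, indexed by the (arbitrarily precise) classical descriptions $\psi$ of all pure states $|\psi\rangle\in\mathcal{H}_D$, is a $d$-dimensional $\varepsilon$-Universal Programmable Hybrid Processor if for every unitary $U\in\mathcal{U}(\mathcal{H}_D)$ there exists a unit vector $|\phi_U\rangle\in\mathcal{H}_M$ such that $$\frac12\Big\|\mathrm{Tr}_M\big[\mathcal{P}_\psi(|\phi_U\rangle\langle\phi_U|)\big]-U|\psi\rangle\langle\psi|U^\dagger\Big\|_1\le\varepsilon\qquad\text{for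 all inputs }\psi .$$ *)

theory Defs
  imports Complex_Main "Jordan_Normal_Form.Schur_Decomposition"
begin

text \<open>
  An \<open>n\<close>-dimensional complex Hilbert space is rendered as \<^term>\<open>carrier_vec n :: complex vec set\<close>
  and its operators as \<^term>\<open>carrier_mat n n :: complex mat set\<close>. A tensor product of spaces of
  dimensions \<open>a\<close> and \<open>b\<close> is the space of dimension \<open>a * b\<close>, the basis vector
  \<open>e\<^sub>i \<otimes> e\<^sub>j\<close> having index \<open>i * b + j\<close>.
\<close>

definition unit_vecs :: "nat \<Rightarrow> complex vec set" where
  "unit_vecs n = {v \<in> carrier_vec n. v \<bullet>c v = 1}"

definition unitaries :: "nat \<Rightarrow> complex mat set" where
  "unitaries n = {U \<in> carrier_mat n n. mat_adjoint U * U = 1\<^sub>m n \<and> U * mat_adjoint U = 1\<^sub>m n}"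

text \<open>The operator \<open>|v\<rangle>\<langle>v|\<close>.\<close>

definition ket_bra :: "complex vec \<Rightarrow> complex mat" where
  "ket_bra v = mat (dim_vec v) (dim_vec v) (\<lambda>(i, j). v $ i * cnj (v $ j))"

definition mat_trace :: "complex mat \<Rightarrow> complex" where
  "mat_trace A = (\<Sum>i<dim_row A. A $$ (i, i))"

text \<open>
  In the order on complex numbers used here, \<open>0 \<le> z\<close> says that \<open>z\<close> is real and nonnegative;
  hence the condition below includes that \<open>A\<close> is Hermitian.
\<close>

definition psd :: "nat \<Rightarrow> complex mat \<Rightarrow> bool" where
  "psd n A \<longleftrightarrow> A \<in> carrier_mat n n \<and> (\<forall>v \<in> carrier_vec n. 0 \<le> (A *\<^sub>v v) \<bullet>c v)"

text \<open>
  Only meant for positive semidefinite arguments, which have exactly one positive semidefinite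
  square root.
\<close>

definition mat_sqrt :: "complex mat \<Rightarrow> complex mat" where
  "mat_sqrt A = (THE S. psd (dim_row A) S \<and> S * S = A)"

definition trace_norm :: "complex mat \<Rightarrow> real" where
  "trace_norm A = Re (mat_trace (mat_sqrt (mat_adjoint A * A)))"

text \<open>The partial trace over the second factor of a tensor product of dimensions \<open>d\<close> and \<open>m\<close>.\<close>

definition ptrace2 :: "nat \<Rightarrow> nat \<Rightarrow> complex mat \<Rightarrow> complex mat" where
  "ptrace2 d m A = mat d d (\<lambda>(i, j). \<Sum>k<m. A $$ (i * m + k, j * m + k))"

definition linear_op_map :: "nat \<Rightarrow> nat \<Rightarrow> (complex mat \<Rightarrow> complex mat) \<Rightarrow> bool" where
  "linear_op_map n n' \<Phi> \<longleftrightarrow>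
     (\<forall>X \<in> carrier_mat n n. \<Phi> X \<in> carrier_mat n' n') \<and>
     (\<forall>X \<in> carrier_mat n n. \<forall>Y \<in> carrier_mat n n. \<Phi> (X + Y) = \<Phi> X + \<Phi> Y) \<and>
     (\<forall>c. \<forall>X \<in> carrier_mat n n. \<Phi> (c \<cdot>\<^sub>m X) = c \<cdot>\<^sub>m \<Phi> X)"

text \<open>
  The \<open>(a, b)\<close> block of size \<open>n \<times> n\<close> of an operator on a tensor product whose second factor has
  dimension \<open>n\<close>.
\<close>

definition block :: "nat \<Rightarrow> nat \<Rightarrow> nat \<Rightarrow> complex mat \<Rightarrow> complex mat" where
  "block n a b X = mat n n (\<lambda>(i, j). X $$ (a * n + i, b * n + j))"

text \<open>
  The map \<open>id\<^sub>k \<otimes> \<Phi>\<close> for \<open>\<Phi>\<close> a linear map from \<open>n \<times> n\<close> to \<open>n' \<times> n'\<close> matrices: writing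
  \<open>X = \<Sum>\<^bsub>a,b<k\<^esub> |a\<rangle>\<langle>b| \<otimes> X\<^sub>a\<^sub>b\<close>, it sends \<open>X\<close> to \<open>\<Sum>\<^bsub>a,b<k\<^esub> |a\<rangle>\<langle>b| \<otimes> \<Phi> X\<^sub>a\<^sub>b\<close>.
\<close>

definition id_tensor ::
    "nat \<Rightarrow> nat \<Rightarrow> nat \<Rightarrow> (complex mat \<Rightarrow> complex mat) \<Rightarrow> complex mat \<Rightarrow> complex mat" where
  "id_tensor k n n' \<Phi> X = mat (k * n') (k * n')
     (\<lambda>(r, s). \<Phi> (block n (r div n') (s div n') X) $$ (r mod n', s mod n'))"

definition completely_positive :: "nat \<Rightarrow> nat \<Rightarrow> (complex mat \<Rightarrow> complex mat) \<Rightarrow> bool" where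
  "completely_positive n n' \<Phi> \<longleftrightarrow>
     (\<forall>k X. psd (k * n) X \<longrightarrow> psd (k * n') (id_tensor k n n' \<Phi> X))"

definition trace_preserving :: "nat \<Rightarrow> (complex mat \<Rightarrow> complex mat) \<Rightarrow> bool" where
  "trace_preserving n \<Phi> \<longleftrightarrow> (\<forall>X \<in> carrier_mat n n. mat_trace (\<Phi> X) = mat_trace X)"

text \<open>
  A channel is a function on all matrices of which only the values on
  \<^term>\<open>carrier_mat n n\<close> matter.
\<close>

definition CPTP :: "nat \<Rightarrow> nat \<Rightarrow> (complex mat \<Rightarrow> complex mat) set" where
  "CPTP n n' = {\<Phi>. linear_op_map n n' \<Phi> \<and> completely_positive n n' \<Phi> \<and> trace_preserving n \<Phi>}"

text \<open>
  The family \<open>P\<close> is indexed by the unit vectors \<open>\<psi>\<close> of the data space; its values at other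
  arguments are irrelevant. The program vector \<open>\<phi>\<close> depends on \<open>U\<close> but not on \<open>\<psi>\<close>.
\<close>

definition UPHP ::
    "nat \<Rightarrow> nat \<Rightarrow> real \<Rightarrow> (complex vec \<Rightarrow> complex mat \<Rightarrow> complex mat) \<Rightarrow> bool" where
  "UPHP d m \<epsilon> P \<longleftrightarrow>
     (\<forall>\<psi> \<in> unit_vecs d. P \<psi> \<in> CPTP m (d * m)) \<and>
     (\<forall>U \<in> unitaries d. \<exists>\<phi> \<in> unit_vecs m. \<forall>\<psi> \<in> unit_vecs d.
        1 / 2 * trace_norm (ptrace2 d m (P \<psi> (ket_bra \<phi>)) - U * ket_bra \<psi> * mat_adjoint U) \<le> \<epsilon>)"

end

theory Submission
  imports Defs
begin

text \<open>
  The program for \<open>U\<close> consists of \<open>n\<close> copies of the normalized Choi vector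
  \<open>1 / \<surd>d \<cdot> \<Sum>\<^sub>a |a\<rangle> \<otimes> U|a\<rangle>\<close>, so \<open>m = d\<^bsup>2n\<^esup>\<close>. Knowing \<open>\<psi>\<close>, the processor measures on the first
  half of each copy in turn whether it is in the entrywise conjugate of \<open>\<psi>\<close>. This succeeds with
  probability \<open>1 / d\<close> and then leaves the second half in the state \<open>U\<psi>\<close>, which is the output. If
  all \<open>n\<close> copies fail, the output is the maximally mixed state, at trace distance \<open>1 - 1 / d\<close> from
  \<open>U\<psi>\<close>. The error is thus \<open>(1 - 1 / d)\<^bsup>n + 1\<^esup> \<le> exp (-(n + 1) / d)\<close>, which is at most \<open>\<epsilon>\<close> for
  \<open>n = \<lfloor>d ln (1 / \<epsilon>)\<rfloor>\<close>.
\<close>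

section \<open>Finite sums and tensor product indices\<close>

lemma sum_lessThan_mult:
  fixes f :: "nat \<Rightarrow> 'a :: comm_monoid_add"
  shows "(\<Sum>x<a * b. f x) = (\<Sum>i<a. \<Sum>j<b. f (i * b + j))"
proof -
  have "(\<Sum>x<a * b. f x) = (\<Sum>i<a. sum f {i * b..<i * b + b})"
    by (rule sum.nat_group[symmetric])
  also have "\<dots> = (\<Sum>i<a. \<Sum>j<b. f (i * b + j))"
  proof (rule sum.cong[OF refl])
    fix i
    show "sum f {i * b..<i * b + b} = (\<Sum>j<b. f (i * b + j))"
      using sum.shift_bounds_nat_ivl[of f 0 "i * b" b]
      by (simp add: atLeast0LessThan add.commute)
  qed
  finally show ?thesis .
qed

lemma sum_rotate3:
  "(\<Sum>i\<in>A. \<Sum>j\<in>B. \<Sum>l\<in>C. f i j l) = (\<Sum>l\<in>C. \<Sum>i\<in>A. \<Sum>j\<in>B. f i j l)"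
proof -
  have "(\<Sum>i\<in>A. \<Sum>j\<in>B. \<Sum>l\<in>C. f i j l) = (\<Sum>i\<in>A. \<Sum>l\<in>C. \<Sum>j\<in>B. f i j l)"
    by (rule sum.cong[OF refl], rule sum.swap)
  also have "\<dots> = (\<Sum>l\<in>C. \<Sum>i\<in>A. \<Sum>j\<in>B. f i j l)"
    by (rule sum.swap)
  finally show ?thesis .
qed

lemma sum_swap_pairs:
  "(\<Sum>i\<in>A. \<Sum>j\<in>B. \<Sum>k\<in>C. \<Sum>l\<in>D. f i j k l) = (\<Sum>k\<in>C. \<Sum>l\<in>D. \<Sum>i\<in>A. \<Sum>j\<in>B. f i j k l)"
  by (rule trans[OF sum_rotate3], rule sum.cong[OF refl], rule sum_rotate3)

lemma index_lt_mult: "(a::nat) < k \<Longrightarrow> i < n \<Longrightarrow> a * n + i < k * n"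
proof -
  assume "a < k" "i < n"
  then have "a * n + i < Suc a * n" by simp
  also have "\<dots> \<le> k * n" using \<open>a < k\<close> by (intro mult_le_mono1) simp
  finally show ?thesis .
qed

text \<open>One numbering \<open>h\<close> serves all summands \<open>F\<close> at once. Kraus
  operators can thus be labelled by a convenient finite type and numbered afterwards, with the
  isometry condition and the output formula referring to the same numbering.\<close>

lemma ex_sum_lessThan_reindex:
  assumes "finite A"
  shows "\<exists>(N :: nat) h. \<forall>F :: 'a \<Rightarrow> complex. (\<Sum>k<N. F (h k)) = (\<Sum>x\<in>A. F x)"
proof -
  obtain h where "bij_betw h {0..<card A} A"
    using ex_bij_betw_nat_finite[OF assms] by blast
  then have "(\<Sum>k<card A. F (h k)) = (\<Sum>x\<in>A. F x)" for F :: "'a \<Rightarrow> complex"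
    using sum.reindex_bij_betw[of h "{..<card A}" A F] by (simp add: atLeast0LessThan)
  then show ?thesis by blast
qed

section \<open>Positive semidefinite matrices and channels in Kraus form\<close>

lemma quadratic_form_sum:
  assumes "A \<in> carrier_mat n n" "v \<in> carrier_vec n"
  shows "(A *\<^sub>v v) \<bullet>c v = (\<Sum>r<n. \<Sum>s<n. A $$ (r, s) * v $ s * cnj (v $ r))"
  using assms
  by (auto simp: scalar_prod_def atLeast0LessThan sum_distrib_right)

lemma psdI:
  assumes "A \<in> carrier_mat n n"
    and "\<And>v. v \<in> carrier_vec n \<Longrightarrow> 0 \<le> (\<Sum>r<n. \<Sum>s<n. A $$ (r, s) * v $ s * cnj (v $ r))"
  shows "psd n A"
  using assms by (simp add: psd_def quadratic_form_sum)

text \<open>The test vector is an arbitrary function \<open>w\<close>, since later test vectors are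
  given by formulas in their indices.\<close>

lemma psd_form_nonneg:
  assumes "psd n A"
  shows "0 \<le> (\<Sum>r<n. \<Sum>s<n. A $$ (r, s) * w s * cnj (w r))"
proof -
  have "0 \<le> (A *\<^sub>v vec n w) \<bullet>c vec n w"
    using assms by (simp add: psd_def)
  moreover have "(A *\<^sub>v vec n w) \<bullet>c vec n w = (\<Sum>r<n. \<Sum>s<n. A $$ (r, s) * w s * cnj (w r))"
    using assms by (subst quadratic_form_sum[where n = n]) (auto simp: psd_def)
  ultimately show ?thesis by simp
qed

text \<open>Kraus operators are functions of a row and a column index rather than matrices, so that
  operators on tensor products can be given by decoding indices.\<close>

definition kraus_map ::
    "nat \<Rightarrow> nat \<Rightarrow> nat \<Rightarrow> (nat \<Rightarrow> nat \<Rightarrow> nat \<Rightarrow> complex) \<Rightarrow> complex mat \<Rightarrow> complex mat" where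
  "kraus_map n n' N L X = mat n' n'
     (\<lambda>(r, s). \<Sum>k<N. \<Sum>x<n. \<Sum>y<n. L k r x * X $$ (x, y) * cnj (L k s y))"

text \<open>The condition \<open>\<Sum>\<^sub>k L\<^sub>k\<^sup>\<dagger> L\<^sub>k = 1\<close>, and the entries of the output \<open>\<Sum>\<^sub>k L\<^sub>k |\<phi>\<rangle>\<langle>\<phi>| L\<^sub>k\<^sup>\<dagger>\<close>.\<close>

definition kraus_isometry ::
    "nat \<Rightarrow> nat \<Rightarrow> nat \<Rightarrow> (nat \<Rightarrow> nat \<Rightarrow> nat \<Rightarrow> complex) \<Rightarrow> bool" where
  "kraus_isometry n n' N L \<longleftrightarrow> (\<forall>x<n. \<forall>y<n.
     (\<Sum>k<N. \<Sum>r<n'. cnj (L k r x) * L k r y) = (if x = y then 1 else 0))"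

definition kraus_pure ::
    "nat \<Rightarrow> nat \<Rightarrow> (nat \<Rightarrow> nat \<Rightarrow> nat \<Rightarrow> complex) \<Rightarrow> (nat \<Rightarrow> complex) \<Rightarrow> nat \<Rightarrow> nat \<Rightarrow> complex" where
  "kraus_pure n N L \<phi> i j =
     (\<Sum>k<N. (\<Sum>x<n. L k i x * \<phi> x) * cnj (\<Sum>x<n. L k j x * \<phi> x))"

text \<open>Moving \<open>A l\<close> and \<open>B l\<close> onto the test functions
  \<open>f\<close> and \<open>g\<close> reduces a form in the output of a Kraus sum to forms in its
  input \<open>Z\<close>. Complete positivity uses this for each block.\<close>

lemma kraus_form:
  fixes A B :: "nat \<Rightarrow> nat \<Rightarrow> nat \<Rightarrow> complex"
  shows "(\<Sum>i<p. \<Sum>j<q. (\<Sum>l<N. \<Sum>x<n. \<Sum>y<n. A l i x * Z x y * B l j y) * g j * f i)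
    = (\<Sum>l<N. \<Sum>x<n. \<Sum>y<n. Z x y * (\<Sum>j<q. B l j y * g j) * (\<Sum>i<p. A l i x * f i))"
proof -
  have "(\<Sum>i<p. \<Sum>j<q. (\<Sum>l<N. \<Sum>x<n. \<Sum>y<n. A l i x * Z x y * B l j y) * g j * f i)
    = (\<Sum>i<p. \<Sum>j<q. \<Sum>l<N. \<Sum>x<n. \<Sum>y<n. A l i x * Z x y * B l j y * g j * f i)"
    by (simp add: sum_distrib_right)
  also have "\<dots> = (\<Sum>l<N. \<Sum>x<n. \<Sum>y<n. \<Sum>i<p. \<Sum>j<q. A l i x * Z x y * B l j y * g j * f i)"
    by (simp only: sum_rotate3[of _ "{..<q}" "{..<p}"]
        sum_rotate3[where A = "{..<p}" and B = "{..<q}" and C = "{..<N}"]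
        sum_rotate3[where A = "{..<p}" and B = "{..<q}" and C = "{..<n}"])
  also have "\<dots> = (\<Sum>l<N. \<Sum>x<n. \<Sum>y<n. Z x y * (\<Sum>j<q. B l j y * g j) * (\<Sum>i<p. A l i x * f i))"
    by (intro sum.cong refl, subst sum.swap) (simp add: sum_distrib_left sum_distrib_right mult_ac)
  finally show ?thesis .
qed

text \<open>Testing the extended map on \<open>v\<close> amounts to testing \<open>X\<close> on the
  vectors obtained from \<open>v\<close> by the adjoint Kraus operators. The result is a sum over
  \<open>l\<close> of nonnegative forms.\<close>

lemma completely_positive_kraus_map: "completely_positive n n' (kraus_map n n' N L)"
  unfolding completely_positive_def
proof (intro allI impI)
  fix k X
  assume X: "psd (k * n) X"
  let ?E = "id_tensor k n n' (kraus_map n n' N L) X"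
  show "psd (k * n') ?E"
  proof (rule psdI)
    show "?E \<in> carrier_mat (k * n') (k * n')" by (simp add: id_tensor_def)
  next
    fix v :: "complex vec"
    \<comment> \<open>\<open>w l\<close> is the adjoint of \<open>1 \<otimes> L l\<close> applied to
      \<open>v\<close>; \<open>s div n\<close> is the block and \<open>s mod n\<close> the position
      in it.\<close>
    define w where "w l s = (\<Sum>j<n'. cnj (L l j (s mod n)) * v $ ((s div n) * n' + j))" for l s
    have entry: "?E $$ (a * n' + i, b * n' + j)
      = (\<Sum>l<N. \<Sum>x<n. \<Sum>y<n. L l i x * X $$ (a * n + x, b * n + y) * cnj (L l j y))"
      if "a < k" "b < k" "i < n'" "j < n'" for a b i j
      using that by (simp add: id_tensor_def kraus_map_def block_def index_lt_mult)
    have "(\<Sum>r<k * n'. \<Sum>s<k * n'. ?E $$ (r, s) * v $ s * cnj (v $ r))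
      = (\<Sum>a<k. \<Sum>i<n'. \<Sum>b<k. \<Sum>j<n'.
          (\<Sum>l<N. \<Sum>x<n. \<Sum>y<n. L l i x * X $$ (a * n + x, b * n + y) * cnj (L l j y))
          * v $ (b * n' + j) * cnj (v $ (a * n' + i)))"
      by (simp add: sum_lessThan_mult entry)
    also have "\<dots> = (\<Sum>a<k. \<Sum>b<k. \<Sum>i<n'. \<Sum>j<n'.
          (\<Sum>l<N. \<Sum>x<n. \<Sum>y<n. L l i x * X $$ (a * n + x, b * n + y) * cnj (L l j y))
          * v $ (b * n' + j) * cnj (v $ (a * n' + i)))"
      by (rule sum.cong[OF refl], rule sum.swap)
    also have "\<dots> = (\<Sum>a<k. \<Sum>b<k. \<Sum>l<N. \<Sum>x<n. \<Sum>y<n.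
          X $$ (a * n + x, b * n + y) * w l (b * n + y) * cnj (w l (a * n + x)))"
      by (subst kraus_form) (simp add: w_def)
    also have "\<dots> = (\<Sum>l<N. \<Sum>a<k. \<Sum>b<k. \<Sum>x<n. \<Sum>y<n.
          X $$ (a * n + x, b * n + y) * w l (b * n + y) * cnj (w l (a * n + x)))"
      by (rule sum_rotate3)
    also have "\<dots> = (\<Sum>l<N. \<Sum>a<k. \<Sum>x<n. \<Sum>b<k. \<Sum>y<n.
          X $$ (a * n + x, b * n + y) * w l (b * n + y) * cnj (w l (a * n + x)))"
      by (rule sum.cong[OF refl], rule sum.cong[OF refl], rule sum.swap)
    also have "\<dots> = (\<Sum>l<N. \<Sum>r<k * n. \<Sum>s<k * n. X $$ (r, s) * w l s * cnj (w l r))"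
      by (simp add: sum_lessThan_mult)
    also have "0 \<le> \<dots>"
      by (intro sum_nonneg psd_form_nonneg[OF X])
    finally show "0 \<le> (\<Sum>r<k * n'. \<Sum>s<k * n'. ?E $$ (r, s) * v $ s * cnj (v $ r))" .
  qed
qed

lemma linear_op_map_kraus_map: "linear_op_map n n' (kraus_map n n' N L)"
proof -
  have "kraus_map n n' N L (X + Y) = kraus_map n n' N L X + kraus_map n n' N L Y"
    if "X \<in> carrier_mat n n" "Y \<in> carrier_mat n n" for X Y
    using that by (intro eq_matI) (simp_all add: kraus_map_def ring_distribs sum.distrib)
  moreover have "kraus_map n n' N L (c \<cdot>\<^sub>m X) = c \<cdot>\<^sub>m kraus_map n n' N L X"
    if "X \<in> carrier_mat n n" for c X
    using that by (intro eq_matI) (simp_all add: kraus_map_def sum_distrib_left mult_ac)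
  ultimately show ?thesis by (simp add: linear_op_map_def kraus_map_def)
qed

text \<open>Reordering the sums exposes the entries of
  \<open>\<Sum>\<^sub>k L\<^sub>k\<^sup>\<dagger> L\<^sub>k\<close>, which is the identity.\<close>

lemma trace_preserving_kraus_map:
  assumes "kraus_isometry n n' N L"
  shows "trace_preserving n (kraus_map n n' N L)"
  unfolding trace_preserving_def
proof
  fix X :: "complex mat"
  assume X: "X \<in> carrier_mat n n"
  have "mat_trace (kraus_map n n' N L X)
    = (\<Sum>r<n'. \<Sum>k<N. \<Sum>x<n. \<Sum>y<n. L k r x * X $$ (x, y) * cnj (L k r y))"
    by (simp add: mat_trace_def kraus_map_def)
  also have "\<dots> = (\<Sum>x<n. \<Sum>y<n. \<Sum>r<n'. \<Sum>k<N. L k r x * X $$ (x, y) * cnj (L k r y))"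
    by (rule sum_swap_pairs)
  also have "\<dots> = (\<Sum>x<n. \<Sum>y<n. \<Sum>k<N. \<Sum>r<n'. X $$ (x, y) * (cnj (L k r y) * L k r x))"
    by (rule sum.cong[OF refl], rule sum.cong[OF refl], subst sum.swap) (simp add: mult_ac)
  also have "\<dots> = (\<Sum>x<n. \<Sum>y<n. X $$ (x, y) * (if y = x then 1 else 0))"
    using assms by (simp add: sum_distrib_left[symmetric] kraus_isometry_def)
  also have "\<dots> = (\<Sum>x<n. \<Sum>y<n. if y = x then X $$ (x, y) else 0)"
    by (intro sum.cong refl) simp
  also have "\<dots> = mat_trace X"
    using X by (simp add: mat_trace_def)
  finally show "mat_trace (kraus_map n n' N L X) = mat_trace X" .
qed

lemma kraus_map_CPTP:
  assumes "kraus_isometry n n' N L"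
  shows "kraus_map n n' N L \<in> CPTP n n'"
  unfolding CPTP_def
  by (simp add: linear_op_map_kraus_map completely_positive_kraus_map trace_preserving_kraus_map[OF assms])

section \<open>One measurement round\<close>

lemma sum_if_pull: "(\<Sum>i\<in>A. if P then f i else 0) = (if P then sum f A else 0)"
  by simp

lemma index_decompose:
  fixes x :: nat
  assumes "x < c * n"
  obtains a i where "a < c" "i < n" "x = a * n + i"
proof
  have "n > 0" using assms by (cases n) auto
  then show "x mod n < n" by simp
  show "x div n < c" using assms by (simp add: less_mult_imp_div_less)
  show "x = x div n * n + x mod n" by simp
qed

lemma sum_Plus_Times:
  fixes F :: "nat + nat \<times> nat \<times> nat \<Rightarrow> complex"
  shows "(\<Sum>s\<in>{..<m} <+> {..<d} \<times> {..<d'} \<times> {..<N}. F s)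
    = (\<Sum>r<m. F (Inl r)) + (\<Sum>a<d. \<Sum>b<d'. \<Sum>l<N. F (Inr (a, b, l)))"
  by (subst sum.Plus) (simp_all add: sum.cartesian_product)

text \<open>The matrix with entries
  \<open>(if c = a then 1 else 0) - cnj (\<psi> c) * \<psi> a\<close> is the orthogonal projection
  onto the complement of the conjugate of \<open>\<psi>\<close>. Being Hermitian and idempotent, it
  is its own Gram matrix.\<close>

lemma projection_gram:
  fixes \<psi> :: "nat \<Rightarrow> complex"
  assumes "(\<Sum>a<d. \<psi> a * cnj (\<psi> a)) = 1" "a < d" "a' < d"
  shows "(\<Sum>c<d. cnj ((if c = a then 1 else 0) - cnj (\<psi> c) * \<psi> a) * ((if c = a' then 1 else 0) - cnj (\<psi> c) * \<psi> a'))
    = (if a = a' then 1 else 0) - cnj (\<psi> a) * \<psi> a'"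
proof -
  have "(\<Sum>c<d. cnj ((if c = a then 1 else 0) - cnj (\<psi> c) * \<psi> a) * ((if c = a' then 1 else 0) - cnj (\<psi> c) * \<psi> a'))
    = (\<Sum>c<d. (if c = a then if a = a' then 1 else 0 else 0) - (if c = a then cnj (\<psi> a) * \<psi> a' else 0)
        - (if c = a' then cnj (\<psi> a) * \<psi> a' else 0) + cnj (\<psi> a) * \<psi> a' * (\<psi> c * cnj (\<psi> c)))"
    by (intro sum.cong refl) (simp add: algebra_simps)
  also have "\<dots> = (if a = a' then 1 else 0) - cnj (\<psi> a) * \<psi> a'"
    using assms by (simp add: sum.distrib sum_subtractf sum_distrib_left[symmetric])
  finally show ?thesis .
qed

text \<open>\<open>U b a\<close> is the entry in row \<open>b\<close> and column \<open>a\<close>,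
  so this is \<open>U\<^sup>\<dagger> U = 1\<close> in coordinates.\<close>

definition orthonormal_columns :: "nat \<Rightarrow> (nat \<Rightarrow> nat \<Rightarrow> complex) \<Rightarrow> bool" where
  "orthonormal_columns d U \<longleftrightarrow> (\<forall>a<d. \<forall>a'<d.
     (\<Sum>b<d. U b a * cnj (U b a')) = (if a = a' then 1 else 0))"

text \<open>The memory index \<open>a * (d * m) + (b * m + r)\<close> holds the two halves
  \<open>a\<close>, \<open>b\<close> of one Choi vector and the remaining program \<open>r\<close>.
  On success the second half is the output and \<open>r\<close> is discarded; on failure both halves
  are discarded and \<open>K\<close> runs on \<open>r\<close>. The new operators are fixed before
  \<open>U\<close>, \<open>\<chi>\<close> and \<open>\<phi>\<close>: they may depend on
  \<open>\<psi>\<close> but not on the program.\<close>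

lemma processor_step:
  fixes \<psi> :: "nat \<Rightarrow> complex" and K :: "nat \<Rightarrow> nat \<Rightarrow> nat \<Rightarrow> complex"
  assumes d: "0 < d" and \<psi>: "(\<Sum>a<d. \<psi> a * cnj (\<psi> a)) = 1" and K: "kraus_isometry m d N K"
  obtains N' :: nat and K' :: "nat \<Rightarrow> nat \<Rightarrow> nat \<Rightarrow> complex" where
    "kraus_isometry (d * (d * m)) d N' K'"
    "\<And>U \<chi> \<phi> i j. \<lbrakk>orthonormal_columns d U; (\<Sum>r<m. \<chi> r * cnj (\<chi> r)) = 1;
      \<And>a b r. a < d \<Longrightarrow> b < d \<Longrightarrow> r < m \<Longrightarrow>
        \<phi> (a * (d * m) + (b * m + r)) = U b a / complex_of_real (sqrt d) * \<chi> r;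
      i < d; j < d\<rbrakk> \<Longrightarrow>
      kraus_pure (d * (d * m)) N' K' \<phi> i j
      = (\<Sum>a<d. U i a * \<psi> a) * cnj (\<Sum>a<d. U j a * \<psi> a) / of_nat d
        + (1 - 1 / of_nat d) * kraus_pure m N K \<chi> i j"
proof -
  \<comment> \<open>\<open>Inl\<close> indexes the Kraus operators of the successful measurement, \<open>Inr\<close> those of the failed one,
    where \<open>Q\<close> is the projection complementary to the conjugate of \<open>\<psi>\<close>.\<close>
  define Q where "Q c a = (if c = a then 1 else 0) - cnj (\<psi> c) * \<psi> a" for c a
  define S where "S s i a b r = (case s of
      Inl r' \<Rightarrow> (if r' = r then if i = b then \<psi> a else 0 else 0)
    | Inr (c, b', l) \<Rightarrow> (if b' = b then Q c a * K l i r else 0))"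
    for s :: "nat + nat \<times> nat \<times> nat" and i a b r
  \<comment> \<open>\<open>G\<close> is \<open>S\<close> with the memory index decoded into
    \<open>a\<close>, \<open>b\<close> and \<open>r\<close>.\<close>
  define G where "G s i x = S s i (x div (d * m)) (x mod (d * m) div m) (x mod (d * m) mod m)" for s i x
  let ?A = "{..<m} <+> {..<d} \<times> {..<d} \<times> {..<N}"
  have Q: "(\<Sum>c<d. cnj (Q c a) * Q c a') = Q a a'" if "a < d" "a' < d" for a a'
    unfolding Q_def by (rule projection_gram[OF \<psi> that])
  have G: "G s i (a * (d * m) + (b * m + r)) = S s i a b r" if "b < d" "r < m" for s i a b r
    using that index_lt_mult[OF that] by (simp add: G_def)
  \<comment> \<open>For equal \<open>b\<close> and equal \<open>r\<close>, success contributes the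
    projection onto the conjugate of \<open>\<psi>\<close> and failure contributes \<open>Q\<close>;
    the two add up to the identity.\<close>
  have 1: "(\<Sum>s\<in>?A. \<Sum>i<d. cnj (G s i x) * G s i y) = (if x = y then 1 else 0)"
    if xy: "x < d * (d * m)" "y < d * (d * m)" for x y
  proof -
    obtain a b r where x: "a < d" "b < d" "r < m" "x = a * (d * m) + (b * m + r)"
      using xy(1) by (metis index_decompose)
    obtain a' b' r' where y: "a' < d" "b' < d" "r' < m" "y = a' * (d * m) + (b' * m + r')"
      using xy(2) by (metis index_decompose)
    have eq: "x = y \<longleftrightarrow> a = a' \<and> b = b' \<and> r = r'"
    proof
      assume "x = y"
      then have "x div (d * m) = y div (d * m)" "x mod (d * m) = y mod (d * m)" by simp_all
      then have "a = a'" "b * m + r = b' * m + r'"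
        using x y index_lt_mult[OF x(2,3)] index_lt_mult[OF y(2,3)] by simp_all
      then have "a = a'" "(b * m + r) div m = (b' * m + r') div m" "(b * m + r) mod m = (b' * m + r') mod m"
        by simp_all
      then show "a = a' \<and> b = b' \<and> r = r'" using x y by simp
    qed (use x y in simp)
    have "(\<Sum>s\<in>?A. \<Sum>i<d. cnj (G s i x) * G s i y)
      = (\<Sum>t<m. \<Sum>i<d. cnj (S (Inl t) i a b r) * S (Inl t) i a' b' r')
        + (\<Sum>c<d. \<Sum>e<d. \<Sum>l<N. \<Sum>i<d. cnj (S (Inr (c, e, l)) i a b r) * S (Inr (c, e, l)) i a' b' r')"
      by (simp add: sum_Plus_Times x y G)
    also have "(\<Sum>t<m. \<Sum>i<d. cnj (S (Inl t) i a b r) * S (Inl t) i a' b' r')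
      = (\<Sum>t<m. \<Sum>i<d. if t = r then if i = b then if b = b' \<and> r = r' then cnj (\<psi> a) * \<psi> a' else 0 else 0 else 0)"
      by (intro sum.cong refl) (simp add: S_def)
    also have "\<dots> = (if b = b' \<and> r = r' then cnj (\<psi> a) * \<psi> a' else 0)"
      using x by (simp add: sum_if_pull)
    also have "(\<Sum>c<d. \<Sum>e<d. \<Sum>l<N. \<Sum>i<d. cnj (S (Inr (c, e, l)) i a b r) * S (Inr (c, e, l)) i a' b' r')
      = (\<Sum>c<d. \<Sum>e<d. if e = b then if b = b' then cnj (Q c a) * Q c a' * (\<Sum>l<N. \<Sum>i<d. cnj (K l i r) * K l i r') else 0 else 0)"
      by (intro sum.cong refl) (simp add: S_def sum_distrib_left mult_ac)
    also have "\<dots> = (if b = b' \<and> r = r' then Q a a' else 0)"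
      using x y K by (simp add: Q kraus_isometry_def)
    finally show ?thesis by (simp add: eq Q_def)
  qed
  have 2: "(\<Sum>s\<in>?A. (\<Sum>x<d * (d * m). G s i x * \<phi> x) * cnj (\<Sum>x<d * (d * m). G s j x * \<phi> x))
      = (\<Sum>a<d. U i a * \<psi> a) * cnj (\<Sum>a<d. U j a * \<psi> a) / of_nat d
        + (1 - 1 / of_nat d) * kraus_pure m N K \<chi> i j"
    if U: "orthonormal_columns d U"
      and \<chi>: "(\<Sum>r<m. \<chi> r * cnj (\<chi> r)) = 1"
      and \<phi>: "\<And>a b r. a < d \<Longrightarrow> b < d \<Longrightarrow> r < m \<Longrightarrow>
        \<phi> (a * (d * m) + (b * m + r)) = U b a / complex_of_real (sqrt d) * \<chi> r"
      and ij: "i < d" "j < d"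
    for U :: "nat \<Rightarrow> nat \<Rightarrow> complex" and \<chi> \<phi> i j
  proof -
    let ?q = "complex_of_real (sqrt d)"
    define v where "v i = (\<Sum>a<d. U i a * \<psi> a)" for i
    define w where "w l i = (\<Sum>x<m. K l i x * \<chi> x)" for l i
    \<comment> \<open>Up to the factor 1/\<surd>d, \<open>T c b\<close> is the amplitude left on the
      two halves of the Choi vector after \<open>Q\<close> acts on the first.\<close>
    define T where "T c b = (\<Sum>a<d. Q c a * U b a)" for c b
    have qq: "?q * ?q = of_nat d"
      by (simp flip: of_real_mult)
    have app: "(\<Sum>x<d * (d * m). G s i x * \<phi> x)
        = (\<Sum>a<d. \<Sum>b<d. \<Sum>r<m. S s i a b r * (U b a / ?q * \<chi> r))" for s i
      by (simp add: sum_lessThan_mult G \<phi>)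
    have L: "(\<Sum>x<d * (d * m). G (Inl t) i x * \<phi> x) = v i * \<chi> t / ?q" if "t < m" "i < d" for t i
    proof -
      have "(\<Sum>x<d * (d * m). G (Inl t) i x * \<phi> x)
        = (\<Sum>a<d. \<Sum>b<d. \<Sum>r<m. if r = t then if b = i then \<psi> a * (U i a / ?q * \<chi> t) else 0 else 0)"
        unfolding app by (intro sum.cong refl) (auto simp: S_def)
      also have "\<dots> = v i * \<chi> t / ?q"
        using that by (simp add: v_def sum_distrib_left sum_distrib_right sum_divide_distrib mult_ac)
      finally show ?thesis .
    qed
    have R: "(\<Sum>x<d * (d * m). G (Inr (c, e, l)) i x * \<phi> x) = T c e / ?q * w l i" if "e < d" for c e l i
    proof -
      have "(\<Sum>x<d * (d * m). G (Inr (c, e, l)) i x * \<phi> x)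
        = (\<Sum>a<d. \<Sum>b<d. if b = e then Q c a * U e a / ?q * w l i else 0)"
        unfolding app by (intro sum.cong refl) (auto simp: S_def w_def sum_distrib_left sum_divide_distrib mult_ac)
      also have "\<dots> = T c e / ?q * w l i"
        using that by (simp add: T_def sum_distrib_right sum_divide_distrib)
      finally show ?thesis .
    qed
    \<comment> \<open>The squared Frobenius norm of \<open>T\<close> is the trace of
      \<open>Q\<close>, because the columns of \<open>U\<close> are orthonormal. Divided by
      \<open>d\<close> it is the failure probability.\<close>
    have TT: "(\<Sum>c<d. \<Sum>e<d. T c e * cnj (T c e)) = of_nat d - 1"
    proof -
      have "(\<Sum>c<d. \<Sum>e<d. T c e * cnj (T c e))
        = (\<Sum>c<d. \<Sum>e<d. \<Sum>a<d. \<Sum>a'<d. Q c a * U e a * (cnj (Q c a') * cnj (U e a')))"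
        by (simp add: T_def sum_product)
      also have "\<dots> = (\<Sum>a<d. \<Sum>a'<d. \<Sum>c<d. \<Sum>e<d. Q c a * U e a * (cnj (Q c a') * cnj (U e a')))"
        by (rule sum_swap_pairs)
      also have "\<dots> = (\<Sum>a<d. \<Sum>a'<d. (\<Sum>c<d. cnj (Q c a') * Q c a) * (\<Sum>e<d. U e a * cnj (U e a')))"
        by (simp add: sum_product mult_ac)
      also have "\<dots> = (\<Sum>a<d. \<Sum>a'<d. if a' = a then Q a a else 0)"
        using U by (intro sum.cong refl) (simp add: Q orthonormal_columns_def)
      also have "\<dots> = of_nat d - 1"
        using \<psi> by (simp add: Q_def sum_subtractf mult.commute)
      finally show ?thesis .
    qed
    have "(\<Sum>s\<in>?A. (\<Sum>x<d * (d * m). G s i x * \<phi> x) * cnj (\<Sum>x<d * (d * m). G s j x * \<phi> x))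
      = (\<Sum>t<m. (v i * \<chi> t / ?q) * cnj (v j * \<chi> t / ?q))
        + (\<Sum>c<d. \<Sum>e<d. \<Sum>l<N. (T c e / ?q * w l i) * cnj (T c e / ?q * w l j))"
      unfolding sum_Plus_Times
      by (intro arg_cong2[where f = "(+)"] sum.cong refl) (simp_all only: L R lessThan_iff ij)
    also have "(\<Sum>t<m. (v i * \<chi> t / ?q) * cnj (v j * \<chi> t / ?q))
      = (\<Sum>t<m. v i * cnj (v j) / of_nat d * (\<chi> t * cnj (\<chi> t)))"
      by (simp add: qq[symmetric] mult_ac)
    also have "\<dots> = v i * cnj (v j) / of_nat d"
      by (simp only: sum_distrib_left[symmetric] \<chi> mult_1_right)
    also have "(\<Sum>c<d. \<Sum>e<d. \<Sum>l<N. (T c e / ?q * w l i) * cnj (T c e / ?q * w l j))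
      = (\<Sum>c<d. \<Sum>e<d. T c e * cnj (T c e) * ((\<Sum>l<N. w l i * cnj (w l j)) / of_nat d))"
      by (simp add: qq[symmetric] mult_ac sum_distrib_left sum_divide_distrib)
    also have "\<dots> = (of_nat d - 1) * ((\<Sum>l<N. w l i * cnj (w l j)) / of_nat d)"
      by (simp only: sum_distrib_right[symmetric] TT)
    also have "\<dots> = (1 - 1 / of_nat d) * (\<Sum>l<N. w l i * cnj (w l j))"
      using d by (simp add: field_simps)
    finally show ?thesis by (simp add: v_def w_def kraus_pure_def)
  qed
  have "finite ?A" by simp
  from ex_sum_lessThan_reindex[OF this] obtain N' and h :: "nat \<Rightarrow> nat + nat \<times> nat \<times> nat"
    where h: "(\<Sum>k<N'. F (h k)) = (\<Sum>s\<in>?A. F s)" for F :: "nat + nat \<times> nat \<times> nat \<Rightarrow> complex"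
    by blast
  show thesis
  proof (rule that)
    show "kraus_isometry (d * (d * m)) d N' (\<lambda>k. G (h k))"
      unfolding kraus_isometry_def h[of "\<lambda>s. \<Sum>i<d. cnj (G s i x) * G s i y" for x y] using 1 by blast
    show "kraus_pure (d * (d * m)) N' (\<lambda>k. G (h k)) \<phi> i j
      = (\<Sum>a<d. U i a * \<psi> a) * cnj (\<Sum>a<d. U j a * \<psi> a) / of_nat d
        + (1 - 1 / of_nat d) * kraus_pure m N K \<chi> i j"
      if "orthonormal_columns d U" "(\<Sum>r<m. \<chi> r * cnj (\<chi> r)) = 1"
        "\<And>a b r. a < d \<Longrightarrow> b < d \<Longrightarrow> r < m \<Longrightarrow>
          \<phi> (a * (d * m) + (b * m + r)) = U b a / complex_of_real (sqrt d) * \<chi> r"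
        "i < d" "j < d" for U \<chi> \<phi> i j
      unfolding kraus_pure_def[of "d * (d * m)"]
        h[of "\<lambda>s. (\<Sum>x<d * (d * m). G s i x * \<phi> x) * cnj (\<Sum>x<d * (d * m). G s j x * \<phi> x)"]
      using that by (rule 2)
  qed
qed

section \<open>Matrix square roots and the trace norm\<close>

lemma mat_adjoint_index:
  assumes "A \<in> carrier_mat n n" "i < n" "j < n"
  shows "mat_adjoint A $$ (i, j) = cnj (A $$ (j, i))"
  using assms by (simp add: mat_adjoint_def mat_of_rows_index)

lemma mat_adjoint_carrier:
  assumes "A \<in> carrier_mat n n"
  shows "mat_adjoint A \<in> carrier_mat n n"
  using assms by (auto simp: mat_adjoint_def)

lemma mat_mult_index:
  assumes "A \<in> carrier_mat n n" "B \<in> carrier_mat n n" "i < n" "j < n"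
  shows "(A * B) $$ (i, j) = (\<Sum>k<n. A $$ (i, k) * B $$ (k, j))"
  using assms by (simp add: scalar_prod_def atLeast0LessThan)

lemma mult_cnj_nonneg: "0 \<le> z * cnj z"
  by (simp add: complex_mult_cnj less_eq_complex_def)

text \<open>With \<open>D = S - T\<close> one has \<open>S D + D T = 0\<close>; multiplying by the adjoint of \<open>D\<close> and taking the
  trace gives a sum of two nonnegative terms, the second of which dominates \<open>c\<close> times the squared
  Frobenius norm of \<open>D\<close>.\<close>

lemma psd_sqrt_unique:
  assumes S: "psd n S" and T: "T \<in> carrier_mat n n" and SS: "S * S = T * T" and c: "0 < c"
    and Tc: "\<And>w. complex_of_real c * (\<Sum>r<n. w r * cnj (w r))
      \<le> (\<Sum>r<n. \<Sum>s<n. T $$ (r, s) * w s * cnj (w r))"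
  shows "S = T"
proof -
  have Sc: "S \<in> carrier_mat n n" using S by (simp add: psd_def)
  define D where "D i j = S $$ (i, j) - T $$ (i, j)" for i j
  let ?N = "\<Sum>i<n. \<Sum>k<n. cnj (D i k) * D i k"
  have zero: "(\<Sum>j<n. S $$ (i, j) * D j k) + (\<Sum>j<n. D i j * T $$ (j, k)) = 0"
    if "i < n" "k < n" for i k
  proof -
    have "(\<Sum>j<n. S $$ (i, j) * D j k) + (\<Sum>j<n. D i j * T $$ (j, k))
      = (\<Sum>j<n. S $$ (i, j) * S $$ (j, k)) - (\<Sum>j<n. T $$ (i, j) * T $$ (j, k))"
      unfolding sum.distrib[symmetric] sum_subtractf[symmetric]
      by (intro sum.cong refl) (simp add: D_def algebra_simps)
    also have "\<dots> = (S * S) $$ (i, k) - (T * T) $$ (i, k)"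
      by (simp only: mat_mult_index[OF Sc Sc that] mat_mult_index[OF T T that])
    finally show ?thesis by (simp add: SS)
  qed
  have "0 = (\<Sum>i<n. \<Sum>k<n. ((\<Sum>j<n. S $$ (i, j) * D j k) + (\<Sum>j<n. D i j * T $$ (j, k))) * cnj (D i k))"
    by (simp add: zero)
  also have "\<dots> = (\<Sum>i<n. \<Sum>k<n. \<Sum>j<n. S $$ (i, j) * D j k * cnj (D i k))
      + (\<Sum>i<n. \<Sum>k<n. \<Sum>j<n. T $$ (j, k) * cnj (D i k) * D i j)"
    by (simp add: ring_distribs sum.distrib sum_distrib_left sum_distrib_right mult_ac)
  also have "(\<Sum>i<n. \<Sum>k<n. \<Sum>j<n. S $$ (i, j) * D j k * cnj (D i k))
      = (\<Sum>k<n. \<Sum>i<n. \<Sum>j<n. S $$ (i, j) * D j k * cnj (D i k))"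
    by (rule sum.swap)
  also have "(\<Sum>i<n. \<Sum>k<n. \<Sum>j<n. T $$ (j, k) * cnj (D i k) * D i j)
      = (\<Sum>i<n. \<Sum>j<n. \<Sum>k<n. T $$ (j, k) * cnj (D i k) * cnj (cnj (D i j)))"
    unfolding complex_cnj_cnj by (rule sum.cong[OF refl], rule sum.swap)
  finally have eq: "0 = (\<Sum>k<n. \<Sum>i<n. \<Sum>j<n. S $$ (i, j) * D j k * cnj (D i k))
      + (\<Sum>i<n. \<Sum>j<n. \<Sum>k<n. T $$ (j, k) * cnj (D i k) * cnj (cnj (D i j)))" .
  \<comment> \<open>The test vectors are the columns of \<open>D\<close> in the form of
    \<open>S\<close> and the conjugated rows of \<open>D\<close> in the form of
    \<open>T\<close>.\<close>
  have "0 + complex_of_real c * ?N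
    \<le> (\<Sum>k<n. \<Sum>i<n. \<Sum>j<n. S $$ (i, j) * D j k * cnj (D i k))
      + (\<Sum>i<n. \<Sum>j<n. \<Sum>k<n. T $$ (j, k) * cnj (D i k) * cnj (cnj (D i j)))"
  proof (rule add_mono)
    show "0 \<le> (\<Sum>k<n. \<Sum>i<n. \<Sum>j<n. S $$ (i, j) * D j k * cnj (D i k))"
      by (intro sum_nonneg psd_form_nonneg[OF S])
    show "complex_of_real c * ?N
      \<le> (\<Sum>i<n. \<Sum>j<n. \<Sum>k<n. T $$ (j, k) * cnj (D i k) * cnj (cnj (D i j)))"
      unfolding sum_distrib_left
      by (intro sum_mono order.trans[OF _ Tc]) (simp add: sum_distrib_left)
  qed
  then have "0 + complex_of_real c * ?N \<le> 0"
    unfolding eq[symmetric] .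
  then have "c * (\<Sum>i<n. \<Sum>k<n. (cmod (D i k))\<^sup>2) \<le> 0"
    by (simp add: less_eq_complex_def cmod_power2 power2_eq_square[symmetric] sum.distrib)
  then have "(\<Sum>i<n. \<Sum>k<n. (cmod (D i k))\<^sup>2) \<le> 0"
    using c by (simp add: mult_le_0_iff)
  then have "(\<Sum>i<n. \<Sum>k<n. (cmod (D i k))\<^sup>2) = 0"
    by (intro order.antisym sum_nonneg) auto
  then have "\<forall>i<n. \<forall>k<n. D i k = 0"
    by (simp add: sum_nonneg_eq_0_iff sum_nonneg)
  then show ?thesis
    using Sc T by (intro eq_matI) (auto simp: D_def)
qed

text \<open>As \<open>mat_sqrt\<close> is a definite description, evaluating it takes uniqueness as
  well as a candidate. A candidate bounded below by some \<open>c > 0\<close> suffices for both,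
  without diagonalization.\<close>

lemma mat_sqrt_eqI:
  assumes S: "psd n S" and SS: "S * S = A" and c: "0 < c"
    and Sc: "\<And>w. complex_of_real c * (\<Sum>r<n. w r * cnj (w r))
      \<le> (\<Sum>r<n. \<Sum>s<n. S $$ (r, s) * w s * cnj (w r))"
  shows "mat_sqrt A = S"
proof -
  have Scar: "S \<in> carrier_mat n n" using S by (simp add: psd_def)
  then have "dim_row A = n" using SS by auto
  then show ?thesis
    unfolding mat_sqrt_def
  proof (intro the_equality)
    fix S'
    assume "psd (dim_row A) S' \<and> S' * S' = A"
    then show "S' = S"
      using \<open>dim_row A = n\<close> SS by (intro psd_sqrt_unique[OF _ Scar _ c Sc]) simp_all
  qed (use S SS in simp)
qed

text \<open>The matrix has eigenvalue \<open>p / d\<close> on the complement of \<open>v\<close> and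
  \<open>- p * (1 - 1 / d)\<close> at \<open>v\<close>. The moduli sum to
  \<open>(d - 1) * p / d + p * (1 - 1 / d)\<close>.\<close>

lemma trace_norm_maximally_mixed_diff:
  fixes v :: "nat \<Rightarrow> complex" and p :: real
  assumes d: "2 \<le> d" and p: "0 < p" and v: "(\<Sum>i<d. v i * cnj (v i)) = 1"
  shows "trace_norm (mat d d (\<lambda>(i, j). of_real p * ((if i = j then 1 / of_nat d else 0) - v i * cnj (v j))))
    = 2 * p * (1 - 1 / real d)"
proof -
  let ?I = "\<lambda>i j. if i = j then 1 else (0 :: complex)"
  \<comment> \<open>The combinations of the identity and the projection onto \<open>v\<close> are
    closed under multiplication, so the square root can be sought among them.\<close>
  define R where "R a b = mat d d (\<lambda>(i, j). a * ?I i j + b * (v i * cnj (v j)))" for a b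
  have Rc: "R a b \<in> carrier_mat d d" for a b by (simp add: R_def)
  have RR: "R a b * R a' b' = R (a * a') (a * b' + b * a' + b * b')" for a b a' b'
  proof (rule eq_matI)
    fix i j
    assume "i < dim_row (R (a * a') (a * b' + b * a' + b * b'))"
      "j < dim_col (R (a * a') (a * b' + b * a' + b * b'))"
    then have ij: "i < d" "j < d" by (simp_all add: R_def)
    have "(R a b * R a' b') $$ (i, j)
      = (\<Sum>k<d. (a * ?I i k + b * (v i * cnj (v k))) * (a' * ?I k j + b' * (v k * cnj (v j))))"
      unfolding mat_mult_index[OF Rc Rc ij] using ij by (intro sum.cong refl) (simp add: R_def)
    also have "\<dots> = (\<Sum>k<d. (if k = i then if i = j then a * a' else 0 else 0)
        + (if k = i then a * b' * (v i * cnj (v j)) else 0)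
        + (if k = j then b * a' * (v i * cnj (v j)) else 0)
        + b * b' * (v i * cnj (v j)) * (v k * cnj (v k)))"
      by (intro sum.cong refl) (auto simp: algebra_simps)
    also have "\<dots> = a * a' * ?I i j + (a * b' + b * a' + b * b') * (v i * cnj (v j))"
      using ij by (simp only: sum.distrib sum_distrib_left[symmetric] v) (simp add: algebra_simps)
    finally show "(R a b * R a' b') $$ (i, j) = R (a * a') (a * b' + b * a' + b * b') $$ (i, j)"
      using ij by (simp add: R_def)
  qed (simp_all add: R_def)
  let ?A = "mat d d (\<lambda>(i, j). of_real p * ((if i = j then 1 / of_nat d else 0) - v i * cnj (v j)))"
  define a where "a = complex_of_real (p / d)"
  \<comment> \<open>Chosen so that \<open>a + b\<close> is \<open>p * (1 - 1 / d)\<close>, the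
    modulus of the eigenvalue at \<open>v\<close>. It is nonnegative because
    \<open>d \<ge> 2\<close>, so \<open>?S\<close> is bounded below by \<open>a\<close>.\<close>
  define b where "b = complex_of_real (p * (1 - 2 / d))"
  let ?S = "R a b"
  have A: "?A = R a (- of_real p)"
    by (intro eq_matI) (auto simp: R_def a_def algebra_simps)
  have "mat_adjoint (R a (- of_real p)) = R a (- of_real p)"
  proof (rule eq_matI)
    fix i j
    assume "i < dim_row (R a (- of_real p))" "j < dim_col (R a (- of_real p))"
    then have ij: "i < d" "j < d" by (simp_all add: R_def)
    show "mat_adjoint (R a (- of_real p)) $$ (i, j) = R a (- of_real p) $$ (i, j)"
      unfolding mat_adjoint_index[OF Rc ij] using ij by (simp add: R_def a_def)
  qed (simp_all only: carrier_matD[OF Rc] carrier_matD[OF mat_adjoint_carrier[OF Rc]])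
  moreover have "a * b + b * a + b * b = a * (- of_real p) + (- of_real p) * a + (- of_real p) * (- of_real p)"
    using d unfolding a_def b_def of_real_mult[symmetric] of_real_add[symmetric] of_real_minus[symmetric] of_real_eq_iff
    by (simp add: field_simps)
  ultimately have SS: "?S * ?S = mat_adjoint ?A * ?A"
    by (simp add: A RR)
  have b: "0 \<le> b"
    using d p by (simp add: b_def less_eq_complex_def)
  have form: "(\<Sum>r<d. \<Sum>s<d. ?S $$ (r, s) * w s * cnj (w r))
      = a * (\<Sum>r<d. w r * cnj (w r)) + b * ((\<Sum>r<d. v r * cnj (w r)) * cnj (\<Sum>r<d. v r * cnj (w r)))" for w
  proof -
    have "(\<Sum>r<d. \<Sum>s<d. ?S $$ (r, s) * w s * cnj (w r))
      = (\<Sum>r<d. \<Sum>s<d. (if s = r then a * (w r * cnj (w r)) else 0)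
          + b * ((v r * cnj (w r)) * cnj (v s * cnj (w s))))"
      by (intro sum.cong refl) (auto simp: R_def algebra_simps)
    also have "\<dots> = a * (\<Sum>r<d. w r * cnj (w r)) + b * ((\<Sum>r<d. v r * cnj (w r)) * cnj (\<Sum>r<d. v r * cnj (w r)))"
      unfolding cnj_sum sum_product by (simp add: sum.distrib sum_distrib_left)
    finally show ?thesis .
  qed
  have lower: "complex_of_real (p / d) * (\<Sum>r<d. w r * cnj (w r))
      \<le> (\<Sum>r<d. \<Sum>s<d. ?S $$ (r, s) * w s * cnj (w r))" for w
    unfolding form a_def[symmetric]
    by (intro add_increasing2 mult_nonneg_nonneg b mult_cnj_nonneg order.refl)
  have "0 \<le> a"
    using p by (simp add: a_def less_eq_complex_def)
  then have "psd d ?S"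
    by (intro psdI[OF Rc]) (simp only: form, intro add_nonneg_nonneg mult_nonneg_nonneg sum_nonneg b mult_cnj_nonneg)
  then have "mat_sqrt (mat_adjoint ?A * ?A) = ?S"
    using p d lower by (intro mat_sqrt_eqI[OF _ SS, of d "p / d"]) auto
  moreover have "mat_trace ?S = of_nat d * a + b"
  proof -
    have "mat_trace ?S = (\<Sum>i<d. a + b * (v i * cnj (v i)))"
      by (simp add: mat_trace_def R_def)
    also have "\<dots> = of_nat d * a + b"
      by (simp only: sum.distrib sum_distrib_left[symmetric] v) simp
    finally show ?thesis .
  qed
  ultimately show ?thesis
    using d by (simp add: trace_norm_def) (simp add: a_def b_def field_simps)
qed

section \<open>The program vector and the processor for \<open>n\<close> copies\<close>

text \<open>The most significant digit of \<open>x\<close> in base \<open>d\<close> is the first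
  half \<open>a\<close> of the outermost copy, the next one its second half \<open>b\<close>. The
  empty program is the unit vector of a one-dimensional memory.\<close>

fun choi_program :: "nat \<Rightarrow> (nat \<Rightarrow> nat \<Rightarrow> complex) \<Rightarrow> nat \<Rightarrow> nat \<Rightarrow> complex" where
  "choi_program d U 0 x = 1"
| "choi_program d U (Suc n) x =
    U (x mod (d * d ^ (2 * n)) div d ^ (2 * n)) (x div (d * d ^ (2 * n))) / complex_of_real (sqrt d)
    * choi_program d U n (x mod (d * d ^ (2 * n)) mod d ^ (2 * n))"

lemma choi_program_Suc:
  assumes "b < d" "r < d ^ (2 * n)"
  shows "choi_program d U (Suc n) (a * (d * d ^ (2 * n)) + (b * d ^ (2 * n) + r))
    = U b a / complex_of_real (sqrt d) * choi_program d U n r"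
  using assms index_lt_mult[OF assms] by simp

text \<open>Each copy contributes the factor \<open>1 / d\<close> times the squared Frobenius norm
  of \<open>U\<close>, which is \<open>d\<close>.\<close>

lemma choi_program_norm:
  assumes d: "0 < d"
    and U: "orthonormal_columns d U"
  shows "(\<Sum>x<d ^ (2 * n). choi_program d U n x * cnj (choi_program d U n x)) = 1"
proof (induction n)
  case (Suc n)
  let ?q = "complex_of_real (sqrt d)"
  have qq: "?q * ?q = of_nat d"
    by (simp flip: of_real_mult)
  have pow: "d ^ (2 * Suc n) = d * (d * d ^ (2 * n))" by simp
  have "(\<Sum>x<d ^ (2 * Suc n). choi_program d U (Suc n) x * cnj (choi_program d U (Suc n) x))
    = (\<Sum>a<d. \<Sum>b<d. \<Sum>r<d ^ (2 * n). (U b a / ?q * choi_program d U n r) * cnj (U b a / ?q * choi_program d U n r))"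
    unfolding pow sum_lessThan_mult
    by (intro sum.cong refl) (simp only: choi_program_Suc lessThan_iff)
  also have "\<dots> = (\<Sum>a<d. \<Sum>b<d. U b a * cnj (U b a) / of_nat d
      * (\<Sum>r<d ^ (2 * n). choi_program d U n r * cnj (choi_program d U n r)))"
    by (simp add: qq[symmetric] sum_distrib_left mult_ac)
  also have "\<dots> = 1"
    using d U by (simp add: Suc orthonormal_columns_def sum_divide_distrib[symmetric])
  finally show ?case .
qed simp

text \<open>Each round of \<open>processor_step\<close> multiplies the weight of the maximally mixed
  state by \<open>1 - 1 / d\<close>. The Kraus operators are chosen before \<open>U\<close>, so the
  induction hypothesis gives one processor for all programs.\<close>

lemma processor_exists:
  fixes \<psi> :: "nat \<Rightarrow> complex"
  assumes d: "0 < d" and \<psi>: "(\<Sum>a<d. \<psi> a * cnj (\<psi> a)) = 1"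
  shows "\<exists>N K. kraus_isometry (d ^ (2 * n)) d N K \<and>
    (\<forall>U i j. orthonormal_columns d U \<longrightarrow> i < d \<longrightarrow> j < d \<longrightarrow>
      kraus_pure (d ^ (2 * n)) N K (choi_program d U n) i j
      = (1 - (1 - 1 / of_nat d) ^ n) * ((\<Sum>a<d. U i a * \<psi> a) * cnj (\<Sum>a<d. U j a * \<psi> a))
        + (1 - 1 / of_nat d) ^ n * (if i = j then 1 / of_nat d else 0))"
proof (induction n)
  case 0
  let ?q = "complex_of_real (sqrt d)"
  have qq: "1 / ?q * (1 / ?q) = 1 / of_nat d"
    by (simp flip: of_real_mult)
  \<comment> \<open>Without copies the memory is one-dimensional, and \<open>K k\<close> sends it to
    1/\<surd>d times the \<open>k\<close>-th basis vector; together these operators prepare the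
    maximally mixed state.\<close>
  define K where "K k i x = (if i = k then 1 / ?q else 0)" for k i x :: nat
  have "(\<Sum>k<d. \<Sum>i<d. cnj (K k i x) * K k i y) = 1" for x y
  proof -
    have "(\<Sum>k<d. \<Sum>i<d. cnj (K k i x) * K k i y) = (\<Sum>k<d. \<Sum>i<d. if i = k then 1 / of_nat d else 0)"
      by (intro sum.cong refl) (use qq in \<open>simp add: K_def\<close>)
    also have "\<dots> = 1" using d by simp
    finally show ?thesis .
  qed
  moreover have "(\<Sum>k<d. K k i 0 * cnj (K k j 0)) = (if i = j then 1 / of_nat d else 0)"
    if "i < d" "j < d" for i j
  proof -
    have "(\<Sum>k<d. K k i 0 * cnj (K k j 0)) = (\<Sum>k<d. if k = i then if i = j then 1 / of_nat d else 0 else 0)"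
      by (intro sum.cong refl) (use qq in \<open>simp add: K_def\<close>)
    also have "\<dots> = (if i = j then 1 / of_nat d else 0)" using that by simp
    finally show ?thesis .
  qed
  ultimately show ?case
    by (intro exI[of _ d] exI[of _ K]) (simp add: kraus_isometry_def kraus_pure_def)
next
  case (Suc n)
  let ?m = "d ^ (2 * n)"
  have pow: "d ^ (2 * Suc n) = d * (d * ?m)" by simp
  from Suc.IH obtain N K where iso: "kraus_isometry ?m d N K"
    and val: "\<forall>U i j. orthonormal_columns d U \<longrightarrow> i < d \<longrightarrow> j < d \<longrightarrow>
      kraus_pure ?m N K (choi_program d U n) i j
      = (1 - (1 - 1 / of_nat d) ^ n) * ((\<Sum>a<d. U i a * \<psi> a) * cnj (\<Sum>a<d. U j a * \<psi> a))
        + (1 - 1 / of_nat d) ^ n * (if i = j then 1 / of_nat d else 0)"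
    by (elim exE conjE)
  show ?case
    unfolding pow
  proof (rule processor_step[OF d \<psi> iso], intro exI conjI allI impI)
    fix N' K'
    assume "kraus_isometry (d * (d * ?m)) d N' K'"
    then show "kraus_isometry (d * (d * ?m)) d N' K'" .
  next
    fix N' K' U i j
    assume step: "\<And>U \<chi> \<phi> i j. \<lbrakk>orthonormal_columns d U; (\<Sum>r<?m. \<chi> r * cnj (\<chi> r)) = 1;
        \<And>a b r. a < d \<Longrightarrow> b < d \<Longrightarrow> r < ?m \<Longrightarrow>
          \<phi> (a * (d * ?m) + (b * ?m + r)) = U b a / complex_of_real (sqrt d) * \<chi> r;
        i < d; j < d\<rbrakk> \<Longrightarrow>
        kraus_pure (d * (d * ?m)) N' K' \<phi> i j
        = (\<Sum>a<d. U i a * \<psi> a) * cnj (\<Sum>a<d. U j a * \<psi> a) / of_nat d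
          + (1 - 1 / of_nat d) * kraus_pure ?m N K \<chi> i j"
      and U: "orthonormal_columns d U" and ij: "i < d" "j < d"
    have "kraus_pure (d * (d * ?m)) N' K' (choi_program d U (Suc n)) i j
      = (\<Sum>a<d. U i a * \<psi> a) * cnj (\<Sum>a<d. U j a * \<psi> a) / of_nat d
        + (1 - 1 / of_nat d) * kraus_pure ?m N K (choi_program d U n) i j"
      by (rule step[OF U choi_program_norm[OF d U] choi_program_Suc ij])
    \<comment> \<open>With \<open>q = 1 - 1 / d\<close>, the weight of the target becomes
      \<open>(1 - q) + q * (1 - q ^ n) = 1 - q ^ Suc n\<close>.\<close>
    also have "\<dots> = (1 - (1 - 1 / of_nat d) ^ Suc n) * ((\<Sum>a<d. U i a * \<psi> a) * cnj (\<Sum>a<d. U j a * \<psi> a))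
        + (1 - 1 / of_nat d) ^ Suc n * (if i = j then 1 / of_nat d else 0)"
      unfolding val[rule_format, OF U ij] by (simp only: power_Suc) (simp only: algebra_simps divide_inverse mult_1_left)
    finally show "kraus_pure (d * (d * ?m)) N' K' (choi_program d U (Suc n)) i j
      = (1 - (1 - 1 / of_nat d) ^ Suc n) * ((\<Sum>a<d. U i a * \<psi> a) * cnj (\<Sum>a<d. U j a * \<psi> a))
        + (1 - 1 / of_nat d) ^ Suc n * (if i = j then 1 / of_nat d else 0)" .
  qed
qed

section \<open>The hybrid processor and its error\<close>

text \<open>Writing \<open>r\<close> as \<open>i * m + t\<close>, only \<open>t = 0\<close>
  survives. Such sums arise from Kraus operators that leave the memory in its first basis
  state.\<close>

lemma sum_mod_eq_0:
  fixes m d :: nat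
  assumes "0 < m"
  shows "(\<Sum>r<d * m. if r mod m = 0 then f (r div m) else 0) = (\<Sum>i<d. f i :: complex)"
proof -
  have "(\<Sum>r<d * m. if r mod m = 0 then f (r div m) else 0) = (\<Sum>i<d. \<Sum>t<m. if t = 0 then f i else 0)"
    unfolding sum_lessThan_mult by (rule sum.cong[OF refl], rule sum.cong[OF refl]) simp
  also have "\<dots> = (\<Sum>i<d. f i)" using assms by simp
  finally show ?thesis .
qed

text \<open>With \<open>p = (1 - 1 / d) ^ n\<close>, output minus target is \<open>p\<close> times
  the maximally mixed state minus \<open>p\<close> times the target. Half its trace norm is
  \<open>p * (1 - 1 / d)\<close>, which is why the exponent is \<open>Suc n\<close> for
  \<open>n\<close> copies.\<close>

lemma UPHP_choi:
  assumes d: "2 \<le> d" and \<epsilon>: "(1 - 1 / real d) ^ Suc n \<le> \<epsilon>"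
  shows "\<exists>P. UPHP d (d ^ (2 * n)) \<epsilon> P"
proof -
  let ?m = "d ^ (2 * n)"
  have m: "0 < ?m" using d by simp
  have d0: "0 < d" using d by simp
  define p where "p = (1 - 1 / real d) ^ n"
  have p: "0 < p" using d by (simp add: p_def)
  have pc: "(1 - 1 / of_nat d) ^ n = complex_of_real p" by (simp add: p_def)
  have unit: "(\<Sum>a<d. \<psi> $ a * cnj (\<psi> $ a)) = 1" if "\<psi> \<in> unit_vecs d" for \<psi>
    using that by (auto simp: unit_vecs_def scalar_prod_def atLeast0LessThan)
  \<comment> \<open>The Kraus operators are chosen for each \<open>\<psi>\<close>, while the program
    is a fixed function of \<open>U\<close>; this matches the order of quantifiers in
    \<open>UPHP\<close>.\<close>
  have "\<forall>\<psi>\<in>unit_vecs d. \<exists>N K. kraus_isometry ?m d N K \<and>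
    (\<forall>U i j. orthonormal_columns d U \<longrightarrow> i < d \<longrightarrow> j < d \<longrightarrow>
      kraus_pure ?m N K (choi_program d U n) i j
      = (1 - of_real p) * ((\<Sum>a<d. U i a * \<psi> $ a) * cnj (\<Sum>a<d. U j a * \<psi> $ a))
        + of_real p * (if i = j then 1 / of_nat d else 0))"
    using processor_exists[OF d0 unit, of _ n] unfolding pc by (intro ballI)
  then obtain N K where "\<forall>\<psi>\<in>unit_vecs d. kraus_isometry ?m d (N \<psi>) (K \<psi>) \<and>
    (\<forall>U i j. orthonormal_columns d U \<longrightarrow> i < d \<longrightarrow> j < d \<longrightarrow>
      kraus_pure ?m (N \<psi>) (K \<psi>) (choi_program d U n) i j
      = (1 - of_real p) * ((\<Sum>a<d. U i a * \<psi> $ a) * cnj (\<Sum>a<d. U j a * \<psi> $ a))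
        + of_real p * (if i = j then 1 / of_nat d else 0))"
    unfolding bchoice_iff by (elim exE)
  then have iso: "kraus_isometry ?m d (N \<psi>) (K \<psi>)"
    and val: "orthonormal_columns d U \<Longrightarrow> i < d \<Longrightarrow> j < d \<Longrightarrow>
      kraus_pure ?m (N \<psi>) (K \<psi>) (choi_program d U n) i j
      = (1 - of_real p) * ((\<Sum>a<d. U i a * \<psi> $ a) * cnj (\<Sum>a<d. U j a * \<psi> $ a))
        + of_real p * (if i = j then 1 / of_nat d else 0)"
    if "\<psi> \<in> unit_vecs d" for \<psi> U i j
    using that by simp_all
  \<comment> \<open>The memory is reset to \<open>|0\<rangle>\<close>.\<close>
  define L where "L \<psi> k r x = (if r mod ?m = 0 then K \<psi> k (r div ?m) x else 0)" for \<psi> k r x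
  define P where "P \<psi> = kraus_map ?m (d * ?m) (N \<psi>) (L \<psi>)" for \<psi>
  have "P \<psi> \<in> CPTP ?m (d * ?m)" if \<psi>: "\<psi> \<in> unit_vecs d" for \<psi>
    unfolding P_def
  proof (rule kraus_map_CPTP, unfold kraus_isometry_def, intro allI impI)
    fix x y
    assume xy: "x < ?m" "y < ?m"
    have "(\<Sum>k<N \<psi>. \<Sum>r<d * ?m. cnj (L \<psi> k r x) * L \<psi> k r y)
      = (\<Sum>k<N \<psi>. \<Sum>r<d * ?m. if r mod ?m = 0 then cnj (K \<psi> k (r div ?m) x) * K \<psi> k (r div ?m) y else 0)"
      by (intro sum.cong refl) (simp add: L_def)
    also have "\<dots> = (if x = y then 1 else 0)"
      unfolding sum_mod_eq_0[OF m, where f = "\<lambda>i. cnj (K \<psi> k i x) * K \<psi> k i y" for k]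
      using iso[OF \<psi>] xy by (simp add: kraus_isometry_def)
    finally show "(\<Sum>k<N \<psi>. \<Sum>r<d * ?m. cnj (L \<psi> k r x) * L \<psi> k r y) = (if x = y then 1 else 0)" .
  qed
  moreover have "\<exists>\<phi> \<in> unit_vecs ?m. \<forall>\<psi> \<in> unit_vecs d.
      1 / 2 * trace_norm (ptrace2 d ?m (P \<psi> (ket_bra \<phi>)) - U * ket_bra \<psi> * mat_adjoint U) \<le> \<epsilon>"
    if U: "U \<in> unitaries d" for U
  proof -
    have Uc: "U \<in> carrier_mat d d" and UU: "mat_adjoint U * U = 1\<^sub>m d"
      using U by (auto simp: unitaries_def)
    have iU: "(\<Sum>b<d. U $$ (b, a) * cnj (U $$ (b, a'))) = (if a = a' then 1 else 0)"
      if "a < d" "a' < d" for a a'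
    proof -
      have "(\<Sum>b<d. U $$ (b, a) * cnj (U $$ (b, a'))) = (mat_adjoint U * U) $$ (a', a)"
        unfolding mat_mult_index[OF mat_adjoint_carrier[OF Uc] Uc that(2,1)]
        using that by (intro sum.cong refl) (simp add: mat_adjoint_index[OF Uc])
      then show ?thesis using that by (auto simp: UU)
    qed
    then have oU: "orthonormal_columns d (\<lambda>b a. U $$ (b, a))"
      by (simp add: orthonormal_columns_def)
    define \<phi> where "\<phi> = vec ?m (choi_program d (\<lambda>b a. U $$ (b, a)) n)"
    have \<phi>: "\<phi> \<in> unit_vecs ?m"
      using choi_program_norm[OF d0 oU, of n] by (simp add: unit_vecs_def \<phi>_def scalar_prod_def atLeast0LessThan)
    have "1 / 2 * trace_norm (ptrace2 d ?m (P \<psi> (ket_bra \<phi>)) - U * ket_bra \<psi> * mat_adjoint U) \<le> \<epsilon>"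
      if \<psi>: "\<psi> \<in> unit_vecs d" for \<psi>
    proof -
      define v where "v i = (\<Sum>a<d. U $$ (i, a) * \<psi> $ a)" for i
      have \<psi>c: "dim_vec \<psi> = d" using \<psi> by (auto simp: unit_vecs_def)
      have v1: "(\<Sum>i<d. v i * cnj (v i)) = 1"
      proof -
        have "(\<Sum>i<d. v i * cnj (v i)) = (\<Sum>i<d. \<Sum>a<d. \<Sum>a'<d. \<psi> $ a * cnj (\<psi> $ a') * (U $$ (i, a) * cnj (U $$ (i, a'))))"
          by (simp add: v_def sum_product mult_ac)
        also have "\<dots> = (\<Sum>a<d. \<Sum>a'<d. \<Sum>i<d. \<psi> $ a * cnj (\<psi> $ a') * (U $$ (i, a) * cnj (U $$ (i, a'))))"
          by (rule sum_rotate3[symmetric])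
        also have "\<dots> = (\<Sum>a<d. \<Sum>a'<d. if a' = a then \<psi> $ a * cnj (\<psi> $ a) else 0)"
          unfolding sum_distrib_left[symmetric] by (intro sum.cong refl) (simp add: iU)
        also have "\<dots> = 1" using unit[OF \<psi>] by simp
        finally show ?thesis .
      qed
      have out: "ptrace2 d ?m (P \<psi> (ket_bra \<phi>)) $$ (i, j)
        = (1 - of_real p) * (v i * cnj (v j)) + of_real p * (if i = j then 1 / of_nat d else 0)"
        if ij: "i < d" "j < d" for i j
      proof -
        have "ptrace2 d ?m (P \<psi> (ket_bra \<phi>)) $$ (i, j) = (\<Sum>t<?m. P \<psi> (ket_bra \<phi>) $$ (i * ?m + t, j * ?m + t))"
          using ij by (simp add: ptrace2_def)
        also have "\<dots> = (\<Sum>t<?m. if t = 0 then (\<Sum>k<N \<psi>. \<Sum>x<?m. \<Sum>y<?m. K \<psi> k i x * (\<phi> $ x * cnj (\<phi> $ y)) * cnj (K \<psi> k j y)) else 0)"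
          using ij by (intro sum.cong refl) (simp add: P_def kraus_map_def index_lt_mult L_def ket_bra_def \<phi>_def)
        also have "\<dots> = (\<Sum>k<N \<psi>. (\<Sum>x<?m. K \<psi> k i x * \<phi> $ x) * cnj (\<Sum>x<?m. K \<psi> k j x * \<phi> $ x))"
          using m by (simp add: sum_product mult_ac)
        also have "\<dots> = (1 - of_real p) * (v i * cnj (v j)) + of_real p * (if i = j then 1 / of_nat d else 0)"
          using val[OF \<psi> oU ij] by (simp add: \<phi>_def v_def kraus_pure_def)
        finally show ?thesis .
      qed
      have kc: "ket_bra \<psi> \<in> carrier_mat d d" by (simp add: ket_bra_def \<psi>c)
      have target: "(U * ket_bra \<psi> * mat_adjoint U) $$ (i, j) = v i * cnj (v j)" if ij: "i < d" "j < d" for i j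
      proof -
        have "(U * ket_bra \<psi> * mat_adjoint U) $$ (i, j)
          = (\<Sum>b<d. (\<Sum>a<d. U $$ (i, a) * (\<psi> $ a * cnj (\<psi> $ b))) * cnj (U $$ (j, b)))"
          unfolding mat_mult_index[OF mult_carrier_mat[OF Uc kc] mat_adjoint_carrier[OF Uc] ij]
          using ij by (intro sum.cong refl) (simp only: mat_mult_index[OF Uc kc] mat_adjoint_index[OF Uc]
              lessThan_iff, simp add: ket_bra_def \<psi>c)
        also have "\<dots> = (\<Sum>b<d. \<Sum>a<d. (U $$ (i, a) * \<psi> $ a) * cnj (U $$ (j, b) * \<psi> $ b))"
          by (simp add: sum_distrib_left sum_distrib_right mult_ac)
        also have "\<dots> = v i * cnj (v j)"
          unfolding v_def cnj_sum sum_product by (rule sum.swap)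
        finally show ?thesis .
      qed
      have "ptrace2 d ?m (P \<psi> (ket_bra \<phi>)) - U * ket_bra \<psi> * mat_adjoint U
        = mat d d (\<lambda>(i, j). of_real p * ((if i = j then 1 / of_nat d else 0) - v i * cnj (v j)))"
        (is "?X = ?Y")
      proof (rule eq_matI)
        have c: "U * ket_bra \<psi> * mat_adjoint U \<in> carrier_mat d d"
          using Uc kc mat_adjoint_carrier[OF Uc] by simp
        then show "dim_row ?X = dim_row ?Y" "dim_col ?X = dim_col ?Y" by auto
        fix i j
        assume "i < dim_row ?Y" "j < dim_col ?Y"
        then have ij: "i < d" "j < d" by simp_all
        have "?X $$ (i, j) = ptrace2 d ?m (P \<psi> (ket_bra \<phi>)) $$ (i, j) - (U * ket_bra \<psi> * mat_adjoint U) $$ (i, j)"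
          using c ij by (intro index_minus_mat) auto
        also have "\<dots> = ?Y $$ (i, j)"
          unfolding out[OF ij] target[OF ij] using ij by (simp add: algebra_simps)
        finally show "?X $$ (i, j) = ?Y $$ (i, j)" .
      qed
      then show ?thesis
        using \<epsilon> by (simp only: trace_norm_maximally_mixed_diff[OF d p v1]) (simp add: p_def mult.commute)
    qed
    then show ?thesis using \<phi> by blast
  qed
  ultimately show ?thesis unfolding UPHP_def by blast
qed

section \<open>The number of copies\<close>

theorem theorem4p1:
  fixes d :: nat and \<epsilon> :: real
  assumes "2 \<le> d" and "0 < \<epsilon>" and "\<epsilon> \<le> 1"
  shows "\<exists>m P. UPHP d m \<epsilon> P \<and> real m \<le> (1 / \<epsilon>) powr (4 * real d * ln (real d))"
proof -
  define l where "l = ln (1 / \<epsilon>)"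
  \<comment> \<open>Rounding down gives \<open>n \<le> d * l\<close> for the memory and
    \<open>d * l \<le> n + 1\<close> for the error, whose exponent is \<open>n + 1\<close>. Rounding
    up could give \<open>n = 1\<close>, hence memory \<open>d ^ 2\<close>, for
    \<open>\<epsilon>\<close> close to 1, where the allowed dimension is close to 1.\<close>
  define n where "n = nat \<lfloor>real d * l\<rfloor>"
  have l: "0 \<le> l" using assms by (simp add: l_def)
  have n: "real n \<le> real d * l" "real d * l \<le> real (Suc n)"
    using l by (auto simp: n_def) linarith
  have "(1 - 1 / real d) ^ Suc n \<le> exp (- (1 / real d)) ^ Suc n"
    using assms exp_ge_add_one_self[of "- (1 / real d)"] by (intro power_mono) auto
  also have "\<dots> = exp (- (real (Suc n) / real d))"
    by (simp only: exp_of_nat_mult[symmetric]) simp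
  also have "\<dots> \<le> exp (- l)"
    using n assms by (simp add: field_simps)
  also have "\<dots> = \<epsilon>"
    using assms by (simp add: l_def ln_div)
  finally obtain P where "UPHP d (d ^ (2 * n)) \<epsilon> P"
    using UPHP_choi[OF assms(1)] by blast
  moreover have "real (d ^ (2 * n)) \<le> (1 / \<epsilon>) powr (4 * real d * ln (real d))"
  proof -
    have "real (d ^ (2 * n)) = exp (2 * real n * ln (real d))"
      using assms by (simp add: powr_realpow[symmetric] powr_def)
    also have "2 * real n * ln (real d) \<le> 4 * real d * ln (real d) * l"
    proof -
      have "2 * real n * ln (real d) \<le> 4 * (real d * l) * ln (real d)"
        using n(1) mult_nonneg_nonneg[OF of_nat_0_le_iff l, of d] assms(1)
        by (intro mult_right_mono) (linarith, simp)
      then show ?thesis by (simp add: mult_ac)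
    qed
    also have "exp (4 * real d * ln (real d) * l) = (1 / \<epsilon>) powr (4 * real d * ln (real d))"
      using assms by (simp add: powr_def l_def)
    finally show ?thesis by simp
  qed
  ultimately show ?thesis by blast
qed

end
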